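(* Let $n\ge 3$, let $f:\mathbb{R}^n\to\mathbb{R}$ be a $C^2$ function, and let $\omega=\sum_{i=1}^n\omega_i(x)\,dx^i$ be a $C^1$ differential $1$-form on $\mathbb{R}^n$ with no zeros, such that the Pfaff equation $\omega=0$ is not completely integrable. A point $x_0\in\mathbb{R}^n$ is a nonholonomic constrained critical point of $f$ subject to $\omega=0$ if and only if, for every integral submanifold $M$ of the Pfaff equation $\omega=0$ with $x_0\in M$, the point $x_0$ is a critical point of $f$ constrained by $M$.
   Context: For $x\in\mathbb{R}^n$ put $H_x=\{y\in\mathbb{R}^n : \sum_{i=1}^n\omega_i(x)y^i=0\}$, a hyperplane. The Pfaff equation $\omega=0$ is completely integrable if through each point of $\mathbb{R}^n$ there is one and only one integral manifold of the maximum possible dimension $n-1$ (equivalently, $\omega\wedge d\omega=0$). An integral submanifold of $\omega=0$, of dimension $p$ with $1\le p\le n-1$, is a $p$-dimensional submanifold $M\subset\mathbb{R}^n$ given as the zero set $M=\{x : g_1(x)=0,\dots,g_{n-p}(x)=0\}$ of a submersion $g=(g_1,\dots,g_{n-p})$ (defined on an open subset of $\mathbb{R}^n$), whose tangent spaces satisfy $T_xM\subseteq H_x$ for every $x\in M$; that is, at points of $M$, $dg_1=0,\dots,dg_{n-p}=0$ imply $\omega=0$. The dimension $p$ is not fixed: all integral submanifolds, of every such dimension, are considered. A point $x_0$ is a nonholonomic constrained critical point of $f$ subject to $\omega=0$ if there is $\mu\in\mathbb{R}$ such that $df(x_0)+\mu\,\omega(x_0)=0$, i.e. $\frac{\partial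 f}{\partial x^i}(x_0)+\mu\,\omega_i(x_0)=0$ for $i=1,\dots,n$. For an integral submanifold $M=\{g_1=\dots=g_{n-p}=0\}$, a point $x_0$ is a critical point of $f$ constrained by $M$ if $g_1(x_0)=\dots=g_{n-p}(x_0)=0$ and there are $\lambda_1,\dots,\lambda_{n-p}\in\mathbb{R}$ with $df(x_0)+\lambda_1dg_1(x_0)+\dots+\lambda_{n-p}dg_{n-p}(x_0)=0$. *)

theory Defs
  imports "HOL-Analysis.Analysis"
begin

definition partial_deriv :: "'n \<Rightarrow> (real^'n \<Rightarrow> real) \<Rightarrow> real^'n \<Rightarrow> real" where
  "partial_deriv i f x = frechet_derivative f (at x) (axis i 1)"

text \<open>The set \<open>U\<close> is meant to be open in the next two definitions.\<close>

definition C1_on :: "(real^'n) set \<Rightarrow> (real^'n \<Rightarrow> real) \<Rightarrow> bool" where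
  "C1_on U f \<longleftrightarrow>
     (\<forall>x\<in>U. f differentiable (at x)) \<and> (\<forall>i. continuous_on U (partial_deriv i f))"

definition C2_on :: "(real^'n) set \<Rightarrow> (real^'n \<Rightarrow> real) \<Rightarrow> bool" where
  "C2_on U f \<longleftrightarrow> C1_on U f \<and> (\<forall>i. C1_on U (partial_deriv i f))"

text \<open>A 1-form \<open>\<Sum>i. \<omega>\<^sub>i dx\<^sup>i\<close> is represented by its coefficient map \<open>x \<mapsto> (\<omega>\<^sub>i(x))\<^sub>i\<close>.\<close>

definition C1_form :: "(real^'n \<Rightarrow> real^'n) \<Rightarrow> bool" where
  "C1_form \<omega> \<longleftrightarrow> (\<forall>i. C1_on UNIV (\<lambda>x. \<omega> x $ i))"

definition hyperplane_at :: "(real^'n \<Rightarrow> real^'n) \<Rightarrow> real^'n \<Rightarrow> (real^'n) set" where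
  "hyperplane_at \<omega> x = {y. (\<Sum>i\<in>UNIV. \<omega> x $ i * y $ i) = 0}"

text \<open>
  A map \<open>g : U \<rightarrow> \<real>\<^sup>m\<close> is given by its components \<open>g j\<close> with \<open>j < m\<close>, because \<open>m\<close> varies
  inside the statement; the values of \<open>g j\<close> for \<open>j \<ge> m\<close> or outside \<open>U\<close> are irrelevant.
  Submersions are of class \<open>C\<^sup>1\<close>, with differential onto \<open>\<real>\<^sup>m\<close> at each point of \<open>U\<close>.
\<close>

definition submersion_on ::
    "nat \<Rightarrow> (real^'n) set \<Rightarrow> (nat \<Rightarrow> real^'n \<Rightarrow> real) \<Rightarrow> bool" where
  "submersion_on m U g \<longleftrightarrow>
     open U \<and> (\<forall>j<m. C1_on U (g j)) \<and>
     (\<forall>x\<in>U. \<forall>c :: nat \<Rightarrow> real. \<exists>v. \<forall>j<m. frechet_derivative (g j) (at x) v = c j)"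

definition zero_locus ::
    "nat \<Rightarrow> (real^'n) set \<Rightarrow> (nat \<Rightarrow> real^'n \<Rightarrow> real) \<Rightarrow> (real^'n) set" where
  "zero_locus m U g = {x \<in> U. \<forall>j<m. g j x = 0}"

text \<open>Meaningful only at points \<open>x\<close> of the zero locus of a submersion \<open>g\<close>.\<close>

definition tangent_space_at ::
    "nat \<Rightarrow> (nat \<Rightarrow> real^'n \<Rightarrow> real) \<Rightarrow> real^'n \<Rightarrow> (real^'n) set" where
  "tangent_space_at m g x = {v. \<forall>j<m. frechet_derivative (g j) (at x) v = 0}"

text \<open>
  \<open>integral_submanifold \<omega> p U g\<close>: the zero locus of \<open>g = (g 0, \<dots>, g (n - p - 1))\<close> in \<open>U\<close> is an
  integral submanifold of \<open>\<omega> = 0\<close> of dimension \<open>p\<close>, where \<open>n = CARD('n)\<close>.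
\<close>

definition integral_submanifold ::
    "(real^'n \<Rightarrow> real^'n) \<Rightarrow> nat \<Rightarrow> (real^'n) set \<Rightarrow> (nat \<Rightarrow> real^'n \<Rightarrow> real) \<Rightarrow> bool" where
  "integral_submanifold \<omega> p U g \<longleftrightarrow>
     1 \<le> p \<and> p \<le> CARD('n) - 1 \<and>
     submersion_on (CARD('n) - p) U g \<and>
     (\<forall>x \<in> zero_locus (CARD('n) - p) U g.
        tangent_space_at (CARD('n) - p) g x \<subseteq> hyperplane_at \<omega> x)"

definition integral_hypersurface_through ::
    "(real^'n \<Rightarrow> real^'n) \<Rightarrow> real^'n \<Rightarrow> (real^'n) set \<Rightarrow> bool" where
  "integral_hypersurface_through \<omega> x M \<longleftrightarrow>
     x \<in> M \<and>
     (\<exists>U g. integral_submanifold \<omega> (CARD('n) - 1) U g \<and>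
            M = zero_locus (CARD('n) - (CARD('n) - 1)) U g)"

text \<open>
  Shrinking the domain of the submersion gives another integral manifold through the same
  point, so the one through \<open>x\<close> can only be unique as a germ at \<open>x\<close>.
\<close>

definition completely_integrable :: "(real^'n \<Rightarrow> real^'n) \<Rightarrow> bool" where
  "completely_integrable \<omega> \<longleftrightarrow>
     (\<forall>x. (\<exists>M. integral_hypersurface_through \<omega> x M) \<and>
          (\<forall>M N. integral_hypersurface_through \<omega> x M \<and> integral_hypersurface_through \<omega> x N \<longrightarrow>
             (\<exists>W. open W \<and> x \<in> W \<and> M \<inter> W = N \<inter> W)))"

definition nonholonomic_critical_point ::
    "(real^'n \<Rightarrow> real) \<Rightarrow> (real^'n \<Rightarrow> real^'n) \<Rightarrow> real^'n \<Rightarrow> bool" where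
  "nonholonomic_critical_point f \<omega> x0 \<longleftrightarrow>
     (\<exists>\<mu>::real. \<forall>i. partial_deriv i f x0 + \<mu> * \<omega> x0 $ i = 0)"

definition constrained_critical_point ::
    "(real^'n \<Rightarrow> real) \<Rightarrow> nat \<Rightarrow> (real^'n) set \<Rightarrow> (nat \<Rightarrow> real^'n \<Rightarrow> real) \<Rightarrow> real^'n \<Rightarrow> bool" where
  "constrained_critical_point f m U g x0 \<longleftrightarrow>
     x0 \<in> zero_locus m U g \<and>
     (\<exists>l :: nat \<Rightarrow> real. \<forall>v. frechet_derivative f (at x0) v
        + (\<Sum>j<m. l j * frechet_derivative (g j) (at x0) v) = 0)"

end

theory Submission
  imports Defs
begin

text \<open>
  If \<open>df + \<mu>\<omega> = 0\<close> at \<open>x0\<close>, then \<open>df\<close> vanishes on \<open>ker \<omega>\<close>, hence on the tangent space of every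
  integral submanifold through \<open>x0\<close>, and so \<open>df\<close> is a combination of the \<open>dg j\<close>.  Conversely,
  integral curves suffice: each nonzero \<open>v\<close> in \<open>ker (\<omega> x0)\<close> extends to a Lipschitz vector field
  annihilated by \<open>\<omega>\<close> near \<open>x0\<close>, whose integral curve through \<open>x0\<close> is a one-dimensional integral
  submanifold with tangent \<open>v\<close>.  Criticality along it gives \<open>df v = 0\<close>, and a functional
  vanishing on \<open>ker (\<omega> x0)\<close> is a multiple of \<open>\<omega> x0\<close>.
\<close>

section \<open>Local solutions of autonomous differential equations\<close>

text \<open>The solution is the fixed point of the Picard operator on bounded continuous functions
  with values in the ball. Freezing time outside [-\<epsilon>, \<epsilon>] makes every iterate a
  function on all of the real line, which is why \<open>\<gamma>\<close> is continuous and stays in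
  the ball for every \<open>t\<close>, although the equation holds only for small
  \<open>t\<close>.\<close>

lemma picard_autonomous:
  fixes F :: "'a::euclidean_space \<Rightarrow> 'a"
  assumes r: "r > 0" and lip: "K-lipschitz_on (cball x0 r) F"
  obtains \<epsilon> \<gamma> where "\<epsilon> > 0" "\<gamma> 0 = x0" "\<And>t::real. \<gamma> t \<in> cball x0 r" "continuous_on UNIV \<gamma>"
    "\<And>t. \<bar>t\<bar> < \<epsilon> \<Longrightarrow> (\<gamma> has_vector_derivative F (\<gamma> t)) (at t)"
proof -
  have K: "K \<ge> 0" using lip by (rule lipschitz_on_nonneg)
  have contF: "continuous_on (cball x0 r) F"
    using lip by (rule lipschitz_on_continuous_on)
  then have "bounded (F ` cball x0 r)"
    by (intro compact_imp_bounded compact_continuous_image) auto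
  then obtain B where B: "B > 0" "\<And>x. x \<in> cball x0 r \<Longrightarrow> norm (F x) \<le> B"
    unfolding bounded_pos by auto
  \<comment> \<open>The first bound keeps Picard iterates inside the ball, the second makes the
    operator a contraction with factor 1/2; \<open>K + 1\<close> avoids a division by zero when
    \<open>K = 0\<close>. The 3 in both comes from the bound on \<open>J\<close> below.\<close>
  define \<epsilon> where "\<epsilon> = min (r / (3 * B)) (1 / (6 * (K + 1)))"
  have \<epsilon>: "\<epsilon> > 0" using r B K by (auto simp: \<epsilon>_def)
  have \<epsilon>B: "3 * \<epsilon> * B \<le> r"
  proof -
    have "\<epsilon> \<le> r / (3 * B)" by (simp add: \<epsilon>_def)
    then show ?thesis using B by (simp add: field_simps)
  qed
  have \<epsilon>K: "3 * \<epsilon> * K \<le> 1/2"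
  proof -
    have "\<epsilon> \<le> 1 / (6 * (K + 1))" by (simp add: \<epsilon>_def)
    then have "6 * \<epsilon> * (K + 1) \<le> 1" using K by (simp add: field_simps)
    then show ?thesis using \<epsilon> by (simp add: algebra_simps)
  qed
  \<comment> \<open>This is the integral of \<open>G\<close> from 0 to the clamped time; basing both
    integrals at -\<epsilon> treats negative times without a sign distinction.\<close>
  define J where "J G t = integral {-\<epsilon>..clamp (-\<epsilon>) \<epsilon> t} G - integral {-\<epsilon>..0} G"
    for G :: "real \<Rightarrow> 'a" and t :: real
  have clamp: "-\<epsilon> \<le> clamp (-\<epsilon>) \<epsilon> t \<and> clamp (-\<epsilon>) \<epsilon> t \<le> \<epsilon>" for t
    using clamp_in_interval[of "-\<epsilon>" \<epsilon> t] \<epsilon> by simp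
  \<comment> \<open>The two intervals of integration have length at most 2 \<epsilon> and
    \<epsilon>, hence the factor 3.\<close>
  have Jbound: "norm (J G t) \<le> 3 * \<epsilon> * C"
    if "continuous_on UNIV G" "\<And>s. norm (G s) \<le> C" for G t C
  proof -
    have C: "C \<ge> 0" using that(2)[of 0] norm_ge_zero[of "G 0"] by linarith
    have "norm (integral {-\<epsilon>..clamp (-\<epsilon>) \<epsilon> t} G) \<le> C * (clamp (-\<epsilon>) \<epsilon> t - (-\<epsilon>))"
      using clamp[of t] that by (intro integral_bound) (auto intro: continuous_on_subset)
    moreover have "norm (integral {-\<epsilon>..0} G) \<le> C * (0 - (-\<epsilon>))"
      using \<epsilon> that by (intro integral_bound) (auto intro: continuous_on_subset)
    moreover have "C * (clamp (-\<epsilon>) \<epsilon> t - (-\<epsilon>)) \<le> C * (2 * \<epsilon>)"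
      using clamp[of t] C by (intro mult_left_mono) auto
    ultimately show ?thesis unfolding J_def
      using norm_triangle_ineq4[of "integral {-\<epsilon>..clamp (-\<epsilon>) \<epsilon> t} G" "integral {-\<epsilon>..0} G"]
      by (simp add: algebra_simps)
  qed
  have Jcont: "continuous_on UNIV (J G)" if "continuous_on UNIV G" for G
  proof -
    have "continuous_on (cbox (-\<epsilon>) \<epsilon>) (\<lambda>t. integral {-\<epsilon>..t} G)"
      using that unfolding box_real
      by (intro indefinite_integral_continuous_1 integrable_continuous_real)
        (auto intro: continuous_on_subset)
    then show ?thesis unfolding J_def
      by (intro continuous_intros clamp_continuous_on)
  qed
  \<comment> \<open>\<open>Bcontfun\<close> yields a meaningful value only for bounded continuous
    functions, so the formula for \<open>T\<close> is available only on \<open>S\<close>, where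
    \<open>F\<close> is evaluated inside the ball.\<close>
  define T where "T \<phi> = Bcontfun (\<lambda>t. x0 + J (\<lambda>s. F (apply_bcontfun \<phi> s)) t)" for \<phi>
  define S where "S = PiC UNIV (\<lambda>_::real. cball x0 r)"
  have S: "\<phi> \<in> S \<longleftrightarrow> (\<forall>t. apply_bcontfun \<phi> t \<in> cball x0 r)" for \<phi>
    by (auto simp: S_def mem_PiC_iff)
  have comp: "continuous_on UNIV (\<lambda>s. F (apply_bcontfun \<phi> s))" if "\<phi> \<in> S" for \<phi>
    using that by (intro continuous_on_compose2[OF contF]) (auto simp: S)
  have bound: "norm (F (apply_bcontfun \<phi> s)) \<le> B" if "\<phi> \<in> S" for \<phi> s
    using that by (intro B) (auto simp: S)
  have T: "apply_bcontfun (T \<phi>) t = x0 + J (\<lambda>s. F (apply_bcontfun \<phi> s)) t" if "\<phi> \<in> S" for \<phi> t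
  proof -
    have "(\<lambda>t. x0 + J (\<lambda>s. F (apply_bcontfun \<phi> s)) t) \<in> bcontfun"
    proof (rule bcontfun_normI)
      show "continuous_on UNIV (\<lambda>t. x0 + J (\<lambda>s. F (apply_bcontfun \<phi> s)) t)"
        by (intro continuous_intros Jcont comp that)
      show "norm (x0 + J (\<lambda>s. F (apply_bcontfun \<phi> s)) t) \<le> norm x0 + 3 * \<epsilon> * B" for t
        using Jbound[OF comp[OF that] bound[OF that], of t] by (rule norm_triangle_mono[OF order_refl])
    qed
    then show ?thesis unfolding T_def by (simp add: Bcontfun_inverse)
  qed
  have "\<exists>!\<phi>\<in>S. T \<phi> = \<phi>"
  proof (rule Banach_fix[where c = "1/2"])
    show "complete S" unfolding S_def
      by (intro complete_eq_closed[THEN iffD2] closed_PiC) auto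
    show "S \<noteq> {}"
      using r S[of "const_bcontfun x0"] by (auto simp: const_bcontfun.rep_eq)
    show "T ` S \<subseteq> S"
    proof safe
      fix \<phi> assume \<phi>: "\<phi> \<in> S"
      show "T \<phi> \<in> S" unfolding S
      proof
        fix t
        show "apply_bcontfun (T \<phi>) t \<in> cball x0 r"
          using Jbound[OF comp[OF \<phi>] bound[OF \<phi>], of t] \<epsilon>B by (simp add: T[OF \<phi>] dist_norm)
      qed
    qed
    fix \<phi> \<psi> assume \<phi>: "\<phi> \<in> S" and \<psi>: "\<psi> \<in> S"
    show "dist (T \<phi>) (T \<psi>) \<le> 1/2 * dist \<phi> \<psi>"
    proof (rule dist_bound)
      fix t
      let ?D = "\<lambda>s. F (apply_bcontfun \<phi> s) - F (apply_bcontfun \<psi> s)"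
      have int: "(\<lambda>s. F (apply_bcontfun \<theta> s)) integrable_on {-\<epsilon>..u}" if "\<theta> \<in> S" for \<theta> u
        using comp[OF that] by (intro integrable_continuous_real) (auto intro: continuous_on_subset)
      have "apply_bcontfun (T \<phi>) t - apply_bcontfun (T \<psi>) t = J ?D t"
        unfolding T[OF \<phi>] T[OF \<psi>] J_def
        by (simp add: integral_diff[OF int[OF \<phi>] int[OF \<psi>]])
      moreover have "norm (J ?D t) \<le> 3 * \<epsilon> * (K * dist \<phi> \<psi>)"
      proof (rule Jbound)
        show "continuous_on UNIV ?D" by (intro continuous_intros comp \<phi> \<psi>)
        show "norm (?D s) \<le> K * dist \<phi> \<psi>" for s
        proof -
          have "norm (?D s) \<le> K * dist (apply_bcontfun \<phi> s) (apply_bcontfun \<psi> s)"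
            using lipschitz_onD[OF lip, of "apply_bcontfun \<phi> s" "apply_bcontfun \<psi> s"] \<phi> \<psi>
            by (auto simp: S dist_norm)
          also have "\<dots> \<le> K * dist \<phi> \<psi>"
            by (intro mult_left_mono dist_bounded K)
          finally show ?thesis .
        qed
      qed
      moreover have "3 * \<epsilon> * (K * dist \<phi> \<psi>) \<le> 1/2 * dist \<phi> \<psi>"
        using mult_right_mono[OF \<epsilon>K zero_le_dist[of \<phi> \<psi>]] by (simp add: mult.assoc)
      ultimately show "dist (apply_bcontfun (T \<phi>) t) (apply_bcontfun (T \<psi>) t) \<le> 1/2 * dist \<phi> \<psi>"
        by (simp add: dist_norm)
    qed
  qed auto
  then obtain \<phi> where \<phi>: "\<phi> \<in> S" "T \<phi> = \<phi>" by auto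
  have eq: "apply_bcontfun \<phi> t = x0 + J (\<lambda>s. F (apply_bcontfun \<phi> s)) t" for t
    using T[OF \<phi>(1), of t] \<phi>(2) by simp
  have cl: "clamp (-\<epsilon>) \<epsilon> t = t" if "t \<in> {-\<epsilon>..\<epsilon>}" for t
    using that by (intro clamp_cancel_cbox) auto
  show ?thesis
  proof (rule that[of \<epsilon> "apply_bcontfun \<phi>"])
    show "apply_bcontfun \<phi> 0 = x0" using \<epsilon> by (simp add: eq[of 0] J_def cl)
    show "apply_bcontfun \<phi> t \<in> cball x0 r" for t using \<phi> by (simp add: S)
    fix t :: real assume t: "\<bar>t\<bar> < \<epsilon>"
    let ?G = "\<lambda>s. F (apply_bcontfun \<phi> s)"
    have "((\<lambda>u. integral {-\<epsilon>..u} ?G) has_vector_derivative ?G t) (at t within {-\<epsilon>..\<epsilon>})"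
      using t comp[OF \<phi>(1)] by (intro integral_has_vector_derivative)
        (auto intro: continuous_on_subset)
    then have deriv: "((\<lambda>u. x0 + (integral {-\<epsilon>..u} ?G - integral {-\<epsilon>..0} ?G)) has_vector_derivative ?G t)
        (at t within {-\<epsilon>..\<epsilon>})"
      by (auto intro!: derivative_eq_intros)
    have on: "apply_bcontfun \<phi> u = x0 + (integral {-\<epsilon>..u} ?G - integral {-\<epsilon>..0} ?G)"
      if "u \<in> {-\<epsilon>..\<epsilon>}" for u
      using eq[of u] cl[OF that] by (simp add: J_def)
    have "t \<in> {-\<epsilon>..\<epsilon>}" using t by (simp add: abs_less_iff)
    then have "(apply_bcontfun \<phi> has_vector_derivative ?G t) (at t within {-\<epsilon>..\<epsilon>})"
      by (rule has_vector_derivative_transform[OF _ on deriv])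
    then show "(apply_bcontfun \<phi> has_vector_derivative ?G t) (at t)"
      using t at_within_Icc_at[of "-\<epsilon>" t \<epsilon>] by simp
  qed (auto simp: \<epsilon>)
qed

section \<open>Lipschitz bounds for C1 functions and quotients\<close>

lemma has_derivative_partial_deriv:
  fixes h :: "real^'n \<Rightarrow> real"
  assumes "h differentiable (at x)"
  shows "(h has_derivative (\<lambda>v. \<Sum>i\<in>UNIV. v $ i * partial_deriv i h x)) (at x)"
proof -
  have D: "(h has_derivative frechet_derivative h (at x)) (at x)"
    using assms by (simp add: frechet_derivative_works)
  interpret linear "frechet_derivative h (at x)"
    using D by (intro has_derivative_linear)
  have "frechet_derivative h (at x) v = (\<Sum>i\<in>UNIV. v $ i * partial_deriv i h x)" for v
  proof -
    have "frechet_derivative h (at x) v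
        = frechet_derivative h (at x) (\<Sum>i\<in>UNIV. v $ i *\<^sub>R axis i 1)"
      by (simp add: basis_expansion scalar_mult_eq_scaleR[symmetric])
    then show ?thesis by (simp add: sum scaleR partial_deriv_def)
  qed
  then have "frechet_derivative h (at x) = (\<lambda>v. \<Sum>i\<in>UNIV. v $ i * partial_deriv i h x)" by (rule ext)
  with D show ?thesis by (rule subst[rotated])
qed

lemma C1_on_continuous_on: "C1_on U h \<Longrightarrow> continuous_on U h"
  unfolding C1_on_def
  by (meson continuous_at_imp_continuous_on differentiable_imp_continuous_within)

text \<open>Compactness bounds each partial derivative on the ball, the sum of these bounds
  dominates the operator norm of the differential, and the mean value inequality applies because the
  ball is convex.\<close>

lemma C1_on_imp_lipschitz:
  fixes h :: "real^'n \<Rightarrow> real"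
  assumes h: "C1_on U h" and U: "cball x r \<subseteq> U"
  obtains L where "L-lipschitz_on (cball x r) h"
proof -
  have "\<exists>b\<ge>0. \<forall>y\<in>cball x r. \<bar>partial_deriv i h y\<bar> \<le> b" for i
  proof -
    have "continuous_on (cball x r) (partial_deriv i h)"
      using h U by (auto simp: C1_on_def intro: continuous_on_subset)
    then have "bounded (partial_deriv i h ` cball x r)"
      by (intro compact_imp_bounded compact_continuous_image) auto
    then obtain b where "b > 0" "\<forall>y\<in>cball x r. \<bar>partial_deriv i h y\<bar> \<le> b"
      by (auto simp: bounded_pos)
    then show ?thesis by (intro exI[of _ b]) auto
  qed
  then obtain b where b: "\<And>i. b i \<ge> 0" "\<And>i y. y \<in> cball x r \<Longrightarrow> \<bar>partial_deriv i h y\<bar> \<le> b i"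
    by metis
  define B where "B = (\<Sum>i\<in>UNIV. b i)"
  have "B-lipschitz_on (cball x r) h"
  proof (rule lipschitz_onI)
    show "B \<ge> 0" unfolding B_def by (intro sum_nonneg b)
    fix y z assume yz: "y \<in> cball x r" "z \<in> cball x r"
    have "norm (h y - h z) \<le> B * norm (y - z)"
    proof (rule differentiable_bound[OF convex_cball _ _ yz])
      fix w assume w: "w \<in> cball x r"
      show "(h has_derivative (\<lambda>v. \<Sum>i\<in>UNIV. v $ i * partial_deriv i h w)) (at w within cball x r)"
        by (rule has_derivative_at_withinI, rule has_derivative_partial_deriv)
          (use h U w in \<open>auto simp: C1_on_def\<close>)
      show "onorm (\<lambda>v. \<Sum>i\<in>UNIV. v $ i * partial_deriv i h w) \<le> B"
      proof (rule onorm_le)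
        fix v :: "real^'n"
        have "norm (\<Sum>i\<in>UNIV. v $ i * partial_deriv i h w) \<le> (\<Sum>i\<in>UNIV. norm v * b i)"
          using component_le_norm_cart[of v] b w
          by (intro sum_norm_le) (auto simp: abs_mult intro!: mult_mono)
        then show "norm (\<Sum>i\<in>UNIV. v $ i * partial_deriv i h w) \<le> B * norm v"
          by (simp add: B_def sum_distrib_left mult.commute)
      qed
    qed
    then show "dist (h y) (h z) \<le> B * dist y z" by (simp add: dist_norm)
  qed
  then show ?thesis by (rule that)
qed

lemma lipschitz_on_divide:
  fixes a b :: "'a::metric_space \<Rightarrow> real"
  assumes X: "compact X" and a: "L-lipschitz_on X a" and b: "M-lipschitz_on X b"
    and nz: "\<And>x. x \<in> X \<Longrightarrow> b x \<noteq> 0"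
  obtains C where "C-lipschitz_on X (\<lambda>x. a x / b x)"
proof -
  have ca: "continuous_on X (\<lambda>x. a x / b x)" and cb: "continuous_on X (\<lambda>x. 1 / b x)"
    using lipschitz_on_continuous_on[OF a] lipschitz_on_continuous_on[OF b] nz
    by (auto intro!: continuous_intros)
  have "bounded ((\<lambda>x. a x / b x) ` X)" "bounded ((\<lambda>x. 1 / b x) ` X)"
    using X ca cb by (auto intro!: compact_imp_bounded compact_continuous_image)
  then obtain A B where A: "A > 0" "\<And>x. x \<in> X \<Longrightarrow> \<bar>a x / b x\<bar> \<le> A"
    and B: "B > 0" "\<And>x. x \<in> X \<Longrightarrow> \<bar>1 / b x\<bar> \<le> B"
    unfolding bounded_pos by auto
  have L: "L \<ge> 0" "M \<ge> 0" using a b by (auto dest: lipschitz_on_nonneg)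
  have "(B * (L + A * M))-lipschitz_on X (\<lambda>x. a x / b x)"
  proof (rule lipschitz_onI)
    fix x y assume xy: "x \<in> X" "y \<in> X"
    \<comment> \<open>This rewriting leaves only differences of \<open>a\<close> and of
      \<open>b\<close>, multiplied by values of \<open>1 / b\<close> and \<open>a / b\<close>, which
      compactness bounds.\<close>
    have "a x / b x - a y / b y = 1 / b x * ((a x - a y) - a y / b y * (b x - b y))"
      using nz xy by (simp add: field_simps)
    also have "\<bar>\<dots>\<bar> \<le> B * (L * dist x y + A * (M * dist x y))"
      unfolding abs_mult
    proof (intro mult_mono)
      have "\<bar>a x - a y\<bar> \<le> L * dist x y" "\<bar>b x - b y\<bar> \<le> M * dist x y"
        using lipschitz_onD[OF a xy] lipschitz_onD[OF b xy] by (auto simp: dist_real_def)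
      moreover from this have "\<bar>a y / b y\<bar> * \<bar>b x - b y\<bar> \<le> A * (M * dist x y)"
        using A xy by (intro mult_mono) auto
      ultimately show "\<bar>(a x - a y) - a y / b y * (b x - b y)\<bar> \<le> L * dist x y + A * (M * dist x y)"
        using abs_triangle_ineq4[of "a x - a y" "a y / b y * (b x - b y)"] unfolding abs_mult by linarith
    qed (use B xy in auto)
    finally show "dist (a x / b x) (a y / b y) \<le> B * (L + A * M) * dist x y"
      by (simp add: dist_real_def algebra_simps)
  qed (use A B L in auto)
  then show ?thesis by (rule that)
qed

section \<open>Integral curves with prescribed initial direction\<close>

lemma hyperplane_at_eq_inner: "hyperplane_at \<omega> x = {y. \<omega> x \<bullet> y = 0}"
  by (simp add: hyperplane_at_def inner_vec_def)

text \<open>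
  Correcting the constant field \<open>v\<close> in the single direction \<open>k\<close> keeps the other components
  constant, so the integral curve can be parametrised by one of them.
\<close>

lemma integral_curve_through:
  fixes \<omega> :: "real^'n \<Rightarrow> real^'n" and v x0 :: "real^'n"
  assumes \<omega>: "C1_form \<omega>" and nz: "\<omega> x0 \<noteq> 0" and v: "\<omega> x0 \<bullet> v = 0" "v \<noteq> 0"
  obtains i \<epsilon> \<gamma> F where "v $ i \<noteq> 0" "\<epsilon> > 0" "\<gamma> 0 = x0" "F x0 = v"
    "continuous_on UNIV (\<lambda>t::real. F (\<gamma> t))"
    "\<And>t. \<bar>t\<bar> < \<epsilon> \<Longrightarrow> (\<gamma> has_vector_derivative F (\<gamma> t)) (at t)"
    "\<And>t. \<bar>t\<bar> < \<epsilon> \<Longrightarrow> \<gamma> t $ i = x0 $ i + t * v $ i"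
    "\<And>t. F (\<gamma> t) $ i = v $ i" "\<And>t. \<omega> (\<gamma> t) \<bullet> F (\<gamma> t) = 0"
proof -
  obtain k where k: "\<omega> x0 $ k \<noteq> 0" using nz by (auto simp: vec_eq_iff)
  \<comment> \<open>If \<open>v\<close> were a multiple of \<open>axis k 1\<close>, then
    orthogonality to \<open>\<omega> x0\<close> and \<open>\<omega> x0 $ k \<noteq> 0\<close> would
    force \<open>v = 0\<close>.\<close>
  obtain i where i: "i \<noteq> k" "v $ i \<noteq> 0"
  proof (rule ccontr)
    assume "\<not> thesis"
    then have "\<forall>i. i \<noteq> k \<longrightarrow> v $ i = 0" using that by blast
    then have "v = v $ k *\<^sub>R axis k 1" by (auto simp: vec_eq_iff axis_def)
    then have "\<omega> x0 \<bullet> v = \<omega> x0 \<bullet> (v $ k *\<^sub>R axis k 1)" by (rule arg_cong)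
    then have "v $ k = 0" using v k by (simp add: inner_axis)
    then show False using v \<open>v = v $ k *\<^sub>R axis k 1\<close> by (metis scaleR_zero_left)
  qed
  have C1: "C1_on UNIV (\<lambda>x. \<omega> x $ j)" for j using \<omega> by (simp add: C1_form_def)
  have "continuous_on UNIV (\<lambda>x. \<omega> x $ k)" by (rule C1_on_continuous_on[OF C1])
  then have "open {x. \<omega> x $ k \<noteq> 0}"
    by (simp add: open_Collect_neq continuous_on_const)
  \<comment> \<open>The curve will never leave this ball, so the division by
    \<open>\<omega> x $ k\<close> is legitimate all along it.\<close>
  then obtain r where r: "r > 0" "cball x0 r \<subseteq> {x. \<omega> x $ k \<noteq> 0}"
    using k by (auto simp: open_contains_cball)
  have "\<exists>L. L-lipschitz_on (cball x0 r) (\<lambda>x. \<omega> x $ j)" for j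
    using C1_on_imp_lipschitz[OF C1, of x0 r j] by auto
  then obtain L where L: "\<And>j. (L j)-lipschitz_on (cball x0 r) (\<lambda>x. \<omega> x $ j)" by metis
  have "\<exists>M. M-lipschitz_on (cball x0 r) (\<lambda>x. \<Sum>j\<in>J. \<omega> x $ j * v $ j)" if "finite J" for J
    using that
  proof induction
    case empty
    show ?case by (auto intro: lipschitz_on_constant)
  next
    case (insert j J)
    then obtain M where "M-lipschitz_on (cball x0 r) (\<lambda>x. \<Sum>j\<in>J. \<omega> x $ j * v $ j)" by blast
    from lipschitz_on_add[OF lipschitz_on_cmult_real[OF L[of j], of "v $ j"] this]
    show ?case using insert by (auto simp: mult.commute[of _ "v $ j"])
  qed
  from this[of UNIV] obtain M where M: "M-lipschitz_on (cball x0 r) (\<lambda>x. \<omega> x \<bullet> v)"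
    by (auto simp: inner_vec_def)
  obtain C where C: "C-lipschitz_on (cball x0 r) (\<lambda>x. \<omega> x \<bullet> v / \<omega> x $ k)"
    using lipschitz_on_divide[OF compact_cball M L[of k]] r(2) by blast
  \<comment> \<open>This is the projection of \<open>v\<close> onto the kernel of
    \<open>\<omega> x\<close> along the k-th axis; at \<open>x0\<close> the correction vanishes.
    Since \<open>axis k 1\<close> has norm 1, the Lipschitz constant of the coefficient carries over
    to \<open>F\<close>.\<close>
  define F where "F x = v - (\<omega> x \<bullet> v / \<omega> x $ k) *\<^sub>R axis k 1" for x
  have F: "C-lipschitz_on (cball x0 r) F"
    using C unfolding lipschitz_on_def F_def
    by (simp add: dist_norm scaleR_left_diff_distrib[symmetric] abs_minus_commute)
  have tangent: "\<omega> x \<bullet> F x = 0" if "\<omega> x $ k \<noteq> 0" for x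
    using that by (simp add: F_def inner_diff_right inner_axis)
  obtain \<epsilon> \<gamma> where \<gamma>: "\<epsilon> > 0" "\<gamma> 0 = x0" "\<And>t::real. \<gamma> t \<in> cball x0 r" "continuous_on UNIV \<gamma>"
    "\<And>t. \<bar>t\<bar> < \<epsilon> \<Longrightarrow> (\<gamma> has_vector_derivative F (\<gamma> t)) (at t)"
    by (rule picard_autonomous[OF r(1) F]) (rule that)
  have Fi: "F x $ i = v $ i" for x using i by (simp add: F_def axis_def)
  show ?thesis
  proof (rule that[of i \<epsilon> \<gamma> F])
    show "F x0 = v" using v by (simp add: F_def)
    show "continuous_on UNIV (\<lambda>t. F (\<gamma> t))"
      using \<gamma> by (intro continuous_on_compose2[OF lipschitz_on_continuous_on[OF F]]) auto
    show "\<omega> (\<gamma> t) \<bullet> F (\<gamma> t) = 0" for t using \<gamma>(3)[of t] r(2) by (intro tangent) blast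
    fix t :: real assume t: "\<bar>t\<bar> < \<epsilon>"
    \<comment> \<open>By \<open>Fi\<close> the i-th component of the curve has constant velocity, so
      this difference has zero derivative on a convex interval.\<close>
    have "\<gamma> t $ i - t * v $ i = \<gamma> 0 $ i - 0 * v $ i"
    proof (rule has_derivative_zero_unique[where s = "{-\<epsilon><..<\<epsilon>}"
          and f = "\<lambda>t. \<gamma> t $ i - t * v $ i"])
      fix u assume u: "u \<in> {-\<epsilon><..<\<epsilon>}"
      then have "(\<gamma> has_derivative (\<lambda>h. h *\<^sub>R F (\<gamma> u))) (at u)"
        using \<gamma>(5)[of u] by (auto simp: has_vector_derivative_def)
      then have "((\<lambda>t. \<gamma> t $ i) has_derivative (\<lambda>h. (h *\<^sub>R F (\<gamma> u)) $ i)) (at u)"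
        by (rule bounded_linear.has_derivative[OF bounded_linear_vec_nth])
      then have "((\<lambda>t. \<gamma> t $ i - t * v $ i) has_derivative (\<lambda>h. (h *\<^sub>R F (\<gamma> u)) $ i - h * v $ i)) (at u)"
        by (auto intro!: derivative_intros)
      then have "((\<lambda>t. \<gamma> t $ i - t * v $ i) has_derivative (\<lambda>h. 0)) (at u)"
        by (simp add: Fi)
      then show "((\<lambda>t. \<gamma> t $ i - t * v $ i) has_derivative (\<lambda>h. 0)) (at u within {-\<epsilon><..<\<epsilon>})"
        by (rule has_derivative_at_withinI)
    qed (use t in auto)
    then show "\<gamma> t $ i = x0 $ i + t * v $ i" by (simp add: \<gamma>(2))
  qed (use \<gamma> i Fi in auto)
qed

section \<open>Multipliers from joint surjectivity\<close>

text \<open>Surjectivity provides vectors \<open>e j\<close> dual to the functionals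
  \<open>L j\<close>. Subtracting from \<open>v\<close> its components along them leaves a vector in
  the common kernel, so the coefficients are the values \<open>h (e j)\<close>.\<close>

lemma linear_functional_eq_combination:
  fixes L :: "nat \<Rightarrow> 'a::real_vector \<Rightarrow> real"
  assumes L: "\<And>j. j < m \<Longrightarrow> linear (L j)" and h: "linear h"
    and surj: "\<And>c. \<exists>v. \<forall>j<m. L j v = c j"
    and ker: "\<And>v. (\<And>j. j < m \<Longrightarrow> L j v = 0) \<Longrightarrow> h v = 0"
  shows "\<exists>c. \<forall>v. h v = (\<Sum>j<m. c j * L j v)"
proof -
  have "\<exists>e. \<forall>j. \<forall>i<m. L i (e j) = of_bool (i = j)"
    by (rule choice) (intro allI surj)
  then obtain e where e: "\<And>i j. i < m \<Longrightarrow> L i (e j) = of_bool (i = j)" by blast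
  have "h v = (\<Sum>j<m. h (e j) * L j v)" for v
  proof -
    have "h (v - (\<Sum>j<m. L j v *\<^sub>R e j)) = 0"
    proof (rule ker)
      fix i assume i: "i < m"
      have "L i (\<Sum>j<m. L j v *\<^sub>R e j) = (\<Sum>j<m. L j v * of_bool (i = j))"
        using i by (simp add: linear_sum[OF L] linear_cmul[OF L] e)
      also have "\<dots> = L i v" using i by (simp add: of_bool_def if_distrib sum.delta cong: if_cong)
      finally show "L i (v - (\<Sum>j<m. L j v *\<^sub>R e j)) = 0" using i by (simp add: linear_diff[OF L])
    qed
    then show ?thesis
      by (simp add: linear_diff[OF h] linear_sum[OF h] linear_cmul[OF h] mult.commute)
  qed
  then show ?thesis by (intro exI[of _ "\<lambda>j. h (e j)"]) blast
qed

section \<open>Integral curves as zero loci of submersions\<close>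

text \<open>The i-th coordinate of the integral curve is affine in time with nonzero slope, so the
  curve is a graph over that coordinate. The equations say that each of the other coordinates agrees
  with the curve at the time read off from coordinate \<open>i\<close>.\<close>

lemma integral_curve_submanifold:
  fixes \<omega> :: "real^'n \<Rightarrow> real^'n" and v x0 :: "real^'n"
  assumes n: "CARD('n) \<ge> 2"
    and \<omega>: "C1_form \<omega>" and nz: "\<omega> x0 \<noteq> 0" and v: "\<omega> x0 \<bullet> v = 0" "v \<noteq> 0"
  obtains U g where "integral_submanifold \<omega> 1 U g" "x0 \<in> zero_locus (CARD('n) - 1) U g"
    "v \<in> tangent_space_at (CARD('n) - 1) g x0"
proof -
  obtain i \<epsilon> \<gamma> F where vi: "v $ i \<noteq> 0" and \<epsilon>: "\<epsilon> > 0" and \<gamma>0: "\<gamma> 0 = x0" and F0: "F x0 = v"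
    and contF: "continuous_on UNIV (\<lambda>t::real. F (\<gamma> t))"
    and \<gamma>': "\<And>t. \<bar>t\<bar> < \<epsilon> \<Longrightarrow> (\<gamma> has_vector_derivative F (\<gamma> t)) (at t)"
    and \<gamma>i: "\<And>t. \<bar>t\<bar> < \<epsilon> \<Longrightarrow> \<gamma> t $ i = x0 $ i + t * v $ i"
    and Fi: "\<And>t. F (\<gamma> t) $ i = v $ i" and tangent: "\<And>t. \<omega> (\<gamma> t) \<bullet> F (\<gamma> t) = 0"
    by (rule integral_curve_through[OF \<omega> nz v]) (rule that)
  define m where "m = CARD('n) - 1"
  have "card {..<m} = card (UNIV - {i})" by (simp add: m_def card_Diff_singleton)
  then obtain \<sigma> where \<sigma>: "bij_betw \<sigma> {..<m} (UNIV - {i})"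
    using finite_same_card_bij[of "{..<m}" "UNIV - {i}"] by auto
  \<comment> \<open>The inverse of the affine map \<open>t \<mapsto> x0 $ i + t * v $ i\<close>: the
    time at which the curve has the same i-th coordinate as \<open>x\<close>. The slab
    \<open>U\<close> keeps it where the curve is known to be differentiable.\<close>
  define \<tau> where "\<tau> x = (x $ i - x0 $ i) / v $ i" for x :: "real^'n"
  define U where "U = {x. \<bar>\<tau> x\<bar> < \<epsilon>}"
  define g where "g j x = x $ \<sigma> j - \<gamma> (\<tau> x) $ \<sigma> j" for j x
  have cont\<tau>: "continuous_on S \<tau>" for S
    unfolding \<tau>_def by (intro continuous_intros) (use vi in auto)
  have "open U" unfolding U_def
    by (intro open_Collect_less continuous_intros cont\<tau>)
  have g': "(g j has_derivative (\<lambda>w. w $ \<sigma> j - w $ i / v $ i * F (\<gamma> (\<tau> x)) $ \<sigma> j)) (at x)"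
    if "x \<in> U" for j x
  proof -
    have "(\<tau> has_derivative (\<lambda>w. w $ i / v $ i)) (at x)"
      unfolding \<tau>_def using vi
      by (auto intro!: derivative_eq_intros bounded_linear.has_derivative[OF bounded_linear_vec_nth])
    moreover have "(\<gamma> has_derivative (\<lambda>h. h *\<^sub>R F (\<gamma> (\<tau> x)))) (at (\<tau> x))"
      using \<gamma>'[of "\<tau> x"] that by (simp add: U_def has_vector_derivative_def)
    ultimately have "((\<lambda>x. \<gamma> (\<tau> x)) has_derivative (\<lambda>w. (w $ i / v $ i) *\<^sub>R F (\<gamma> (\<tau> x)))) (at x)"
      by (rule has_derivative_compose)
    from bounded_linear.has_derivative[OF bounded_linear_vec_nth this, of "\<sigma> j"]
    have "((\<lambda>x. \<gamma> (\<tau> x) $ \<sigma> j) has_derivative (\<lambda>w. w $ i / v $ i * F (\<gamma> (\<tau> x)) $ \<sigma> j)) (at x)"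
      by simp
    then show ?thesis unfolding g_def
      by (intro has_derivative_diff bounded_linear.has_derivative[OF bounded_linear_vec_nth]) auto
  qed
  have fd: "frechet_derivative (g j) (at x) = (\<lambda>w. w $ \<sigma> j - w $ i / v $ i * F (\<gamma> (\<tau> x)) $ \<sigma> j)"
    if "x \<in> U" for j x
    using frechet_derivative_at[OF g'[OF that]] by simp
  have "C1_on U (g j)" for j
    unfolding C1_on_def
  proof (intro conjI ballI allI)
    fix x assume "x \<in> U"
    then show "g j differentiable at x" using g' by (auto simp: differentiable_def)
  next
    fix k :: 'n
    have "continuous_on U (\<lambda>x. F (\<gamma> (\<tau> x)))"
      by (rule continuous_on_compose2[OF contF cont\<tau>]) auto
    then have "continuous_on U (\<lambda>x. (axis k 1 :: real^'n) $ \<sigma> j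
        - (axis k 1 :: real^'n) $ i / v $ i * F (\<gamma> (\<tau> x)) $ \<sigma> j)"
      by (intro continuous_intros)
    then show "continuous_on U (partial_deriv k (g j))"
      by (rule continuous_on_eq) (simp add: partial_deriv_def fd)
  qed
  moreover have "\<exists>w. \<forall>j<m. frechet_derivative (g j) (at x) w = c j" if x: "x \<in> U" for x and c :: "nat \<Rightarrow> real"
  proof -
    have "\<sigma> j \<noteq> i" "inv_into {..<m} \<sigma> (\<sigma> j) = j" if "j < m" for j
      using \<sigma> that by (auto simp: bij_betw_def dest: inv_into_f_f)
    \<comment> \<open>The witness has i-th component 0, so the second term of each differential
      drops out and \<open>g j\<close> just reads off coordinate \<open>\<sigma> j\<close>.\<close>
    then show ?thesis
      by (intro exI[of _ "\<chi> l. if l = i then 0 else c (inv_into {..<m} \<sigma> l)"])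
        (auto simp: fd[OF x])
  qed
  ultimately have sub: "submersion_on m U g"
    using \<open>open U\<close> by (auto simp: submersion_on_def)
  have eq_off_i: "x = y" if "x $ i = y $ i" "\<And>j. j < m \<Longrightarrow> x $ \<sigma> j = y $ \<sigma> j" for x y :: "real^'n"
  proof -
    have "x $ l = y $ l" for l
    proof (cases "l = i")
      case False
      then have "l \<in> \<sigma> ` {..<m}" using \<sigma> by (auto simp: bij_betw_def)
      then show ?thesis using that(2) by auto
    qed (use that in auto)
    then show ?thesis by (simp add: vec_eq_iff)
  qed
  have "tangent_space_at m g x \<subseteq> hyperplane_at \<omega> x" if x: "x \<in> zero_locus m U g" for x
  proof
    fix w assume w: "w \<in> tangent_space_at m g x"
    have xU: "x \<in> U" using x by (simp add: zero_locus_def)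
    \<comment> \<open>The equations settle all coordinates but \<open>i\<close>, and that one agrees
      by the choice of \<open>\<tau>\<close>.\<close>
    have "x = \<gamma> (\<tau> x)"
      using x vi \<gamma>i[of "\<tau> x"] by (intro eq_off_i) (auto simp: zero_locus_def g_def U_def \<tau>_def)
    \<comment> \<open>The tangent space is the line spanned by the velocity; the scalar is found by
      comparing i-th components through \<open>Fi\<close>.\<close>
    moreover have "w = (w $ i / v $ i) *\<^sub>R F (\<gamma> (\<tau> x))"
      using w vi Fi by (intro eq_off_i) (auto simp: tangent_space_at_def fd[OF xU])
    ultimately have "\<omega> x \<bullet> w = 0"
      using tangent[of "\<tau> x"] by (metis inner_scaleR_right mult_zero_right)
    then show "w \<in> hyperplane_at \<omega> x" by (simp add: hyperplane_at_eq_inner)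
  qed
  then have "integral_submanifold \<omega> 1 U g"
    using sub n by (simp add: integral_submanifold_def m_def)
  moreover have "\<tau> x0 = 0" by (simp add: \<tau>_def)
  then have "x0 \<in> U" "\<And>j. g j x0 = 0" using \<epsilon> \<gamma>0 by (auto simp: U_def g_def)
  moreover from this have "v \<in> tangent_space_at m g x0"
    using \<open>\<tau> x0 = 0\<close> vi \<gamma>0 F0 by (simp add: tangent_space_at_def fd)
  ultimately show ?thesis using that by (auto simp: zero_locus_def m_def)
qed

section \<open>Comparison of the two notions of critical point\<close>

theorem theorem5:
  fixes f :: "real^'n \<Rightarrow> real" and \<omega> :: "real^'n \<Rightarrow> real^'n" and x0 :: "real^'n"
  assumes "CARD('n) \<ge> 3"
    and "C2_on UNIV f"
    and "C1_form \<omega>"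
    and "\<forall>x. \<omega> x \<noteq> 0"
    and "\<not> completely_integrable \<omega>"
  shows "nonholonomic_critical_point f \<omega> x0 \<longleftrightarrow>
    (\<forall>p U g. integral_submanifold \<omega> p U g \<and> x0 \<in> zero_locus (CARD('n) - p) U g \<longrightarrow>
       constrained_critical_point f (CARD('n) - p) U g x0)"
proof -
  have f: "f differentiable (at x0)" using assms(2) by (simp add: C2_on_def C1_on_def)
  define df where "df = frechet_derivative f (at x0)"
  have lin: "linear df" unfolding df_def using f by (rule linear_frechet_derivative)
  have df: "df v = (\<Sum>i\<in>UNIV. v $ i * partial_deriv i f x0)" for v
    unfolding df_def using fun_cong[OF frechet_derivative_at[OF has_derivative_partial_deriv[OF f]], of v] by simp
  show ?thesis
  proof (intro iffI allI impI; (elim conjE)?)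
    fix p U g
    let ?m = "CARD('n) - p"
    assume "nonholonomic_critical_point f \<omega> x0" and M: "integral_submanifold \<omega> p U g"
      and x0: "x0 \<in> zero_locus ?m U g"
    then obtain \<mu> where "\<And>i. partial_deriv i f x0 + \<mu> * \<omega> x0 $ i = 0"
      by (auto simp: nonholonomic_critical_point_def)
    then have "partial_deriv i f x0 = - (\<mu> * \<omega> x0 $ i)" for i by (simp add: add_eq_0_iff2)
    then have df\<omega>: "df v = - \<mu> * (\<omega> x0 \<bullet> v)" for v
      by (simp add: df inner_vec_def sum_distrib_left sum_negf algebra_simps)
    have U: "x0 \<in> U" and sub: "submersion_on ?m U g"
      and tan: "tangent_space_at ?m g x0 \<subseteq> hyperplane_at \<omega> x0"
      using M x0 by (auto simp: integral_submanifold_def zero_locus_def)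
    \<comment> \<open>Representing \<open>- df\<close> instead of \<open>df\<close> gives the
      multipliers the sign required by \<open>constrained_critical_point\<close>.\<close>
    have "\<exists>c. \<forall>v. - df v = (\<Sum>j<?m. c j * frechet_derivative (g j) (at x0) v)"
    proof (rule linear_functional_eq_combination[of ?m "\<lambda>j. frechet_derivative (g j) (at x0)" "\<lambda>v. - df v"])
      show "linear (frechet_derivative (g j) (at x0))" if "j < ?m" for j
        using sub U that by (auto simp: submersion_on_def C1_on_def intro!: linear_frechet_derivative)
      show "linear (\<lambda>v. - df v)" using lin by (rule linear_compose_neg)
      show "\<exists>v. \<forall>j<?m. frechet_derivative (g j) (at x0) v = c j" for c
        using sub U by (auto simp: submersion_on_def)
      fix v assume "\<And>j. j < ?m \<Longrightarrow> frechet_derivative (g j) (at x0) v = 0"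
      then have "v \<in> hyperplane_at \<omega> x0" using tan by (auto simp: tangent_space_at_def)
      then show "- df v = 0" by (simp add: hyperplane_at_eq_inner df\<omega>)
    qed
    then obtain c where c: "\<And>v. - df v = (\<Sum>j<?m. c j * frechet_derivative (g j) (at x0) v)"
      by blast
    have "df v + (\<Sum>j<?m. c j * frechet_derivative (g j) (at x0) v) = 0" for v
      using c[of v] by linarith
    then show "constrained_critical_point f ?m U g x0"
      using x0 by (auto simp: constrained_critical_point_def df_def)
  next
    assume crit: "\<forall>p U g. integral_submanifold \<omega> p U g \<and> x0 \<in> zero_locus (CARD('n) - p) U g \<longrightarrow>
       constrained_critical_point f (CARD('n) - p) U g x0"
    have ker: "df v = 0" if v: "\<omega> x0 \<bullet> v = 0" for v
    proof (cases "v = 0")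
      case False
      obtain U g where g: "integral_submanifold \<omega> 1 U g" "x0 \<in> zero_locus (CARD('n) - 1) U g"
        "v \<in> tangent_space_at (CARD('n) - 1) g x0"
        using integral_curve_submanifold[of \<omega> x0 v] assms v False by auto
      then obtain l where "df v + (\<Sum>j<CARD('n) - 1. l j * frechet_derivative (g j) (at x0) v) = 0"
        using crit unfolding constrained_critical_point_def df_def by blast
      \<comment> \<open>Evaluated at the tangent vector \<open>v\<close>, every term with a
        multiplier vanishes.\<close>
      then show ?thesis using g(3) by (simp add: tangent_space_at_def)
    qed (simp add: linear_0[OF lin])
    \<comment> \<open>The value forced by evaluating the desired identity at
      \<open>\<omega> x0\<close>; the rest of \<open>v\<close>, after removing its orthogonal
      projection onto \<open>\<omega> x0\<close>, lies in the kernel.\<close>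
    define \<mu> where "\<mu> = - df (\<omega> x0) / (\<omega> x0 \<bullet> \<omega> x0)"
    have "df v + \<mu> * (\<omega> x0 \<bullet> v) = 0" for v
    proof -
      have "df (v - (\<omega> x0 \<bullet> v / (\<omega> x0 \<bullet> \<omega> x0)) *\<^sub>R \<omega> x0) = 0"
        using assms(4) by (intro ker) (simp add: inner_diff_right)
      then show ?thesis by (simp add: linear_diff[OF lin] linear_cmul[OF lin] \<mu>_def)
    qed
    from this[of "axis _ 1"] show "nonholonomic_critical_point f \<omega> x0"
      by (auto simp: nonholonomic_critical_point_def partial_deriv_def df_def inner_axis)
  qed
qed

end
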